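(* For every real number $\beta>1$, the beta shift $\Omega_\beta$ is DC$1$-chaotic.
   Context: $\mathbb{N}=\{1,2,\ldots\}$. For $n\ge 2$, $\Omega_n=\{0,1,\ldots,n-1\}^{\mathbb{N}}$ carries the product topology, given by the metric $\rho(\omega,\gamma)=n^{-\min\{k\in\mathbb{N}:\omega_k\ne\gamma_k\}}$ for $\omega\neq\gamma$ and $\rho(\omega,\omega)=0$; $\sigma$ is the shift, $(\sigma(\omega))_i=\omega_{i+1}$. For real $\beta>1$, the expansion of $1$ in base $\beta$ is the sequence $\omega^{(\beta)}$ of nonnegative integers given by $\omega^{(\beta)}_1=\lfloor\beta\rfloor$ and $\omega^{(\beta)}_i=\left\lfloor\beta^i\left(1-\omega^{(\beta)}_1\beta^{-1}-\ldots-\omega^{(\beta)}_{i-1}\beta^{-i+1}\right)\right\rfloor$ for $i\ge2$. Let $\preceq$ be the lexicographic order on $(\mathbb{N}\cup\{0\})^{\mathbb{N}}$. The beta shift is the subshift $\Omega_\beta=\{\omega\in\Omega_{\lceil\beta\rceil}:\sigma^k(\omega)\preceq\omega^{(\beta)}\text{ for all }k\ge0\}$. For points $x,y$ of a subshift $X$ and $t\in\mathbb{R}$ put $F_{xy}(t)=\liminf_{m\to\infty}\frac1m\#\{0\le j\le m-1:\rho(\sigma^j(x),\sigma^j(y))<t\}$ and $F^*_{xy}(t)=\limsup_{m\to\infty}\frac1m\#\{0\le j\le m-1:\rho(\sigma^j(x),\sigma^j(y))<t\}$. A pair $(x,y)$ is DC$1$-scrambled if $F^*_{xy}(t)=1$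 for all $t>0$ and $F_{xy}(s)=0$ for some $s>0$. $X$ is DC$1$-chaotic if there is an uncountable set $S\subset X$ such that every pair of distinct points of $S$ is DC$1$-scrambled. *)

theory Defs
  imports
    Complex_Main
    "HOL-Library.FuncSet"
    "HOL-Library.Fun_Lexorder"
    "HOL-Library.Countable_Set"
    "HOL-Library.Extended_Real"
begin

text \<open>
  Sequences indexed by \<open>{1, 2, \<dots>}\<close> are represented as functions on \<^typ>\<open>nat\<close> whose value
  at \<open>i\<close> is the entry with index \<open>i + 1\<close>; all formulas below are shifted accordingly.
\<close>

definition shift :: "(nat \<Rightarrow> nat) \<Rightarrow> nat \<Rightarrow> nat" where
  "shift x = (\<lambda>i. x (Suc i))"

definition full_shift :: "nat \<Rightarrow> (nat \<Rightarrow> nat) set" where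
  "full_shift n = UNIV \<rightarrow> {..<n}"

definition seq_dist :: "nat \<Rightarrow> (nat \<Rightarrow> nat) \<Rightarrow> (nat \<Rightarrow> nat) \<Rightarrow> real" where
  "seq_dist n x y = (if x = y then 0 else inverse (real n ^ Suc (LEAST k. x k \<noteq> y k)))"

text \<open>
  The digits of the expansion of 1 in base \<open>\<beta>\<close>. For \<open>i = 0\<close> the sum is empty and the digit is
  \<open>\<lfloor>\<beta>\<rfloor>\<close>; the conversion \<^const>\<open>nat\<close> never truncates when \<open>\<beta> > 1\<close>, see
  \<open>int_beta_expansion\<close>.
\<close>

fun beta_expansion :: "real \<Rightarrow> nat \<Rightarrow> nat" where
  "beta_expansion \<beta> i =
     nat \<lfloor>\<beta> ^ Suc i * (1 - (\<Sum>j<i. real (beta_expansion \<beta> j) / \<beta> ^ Suc j))\<rfloor>"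

declare beta_expansion.simps [simp del]

lemma beta_expansion_remainder_nonneg:
  assumes "\<beta> > 1"
  shows "0 \<le> 1 - (\<Sum>j<i. real (beta_expansion \<beta> j) / \<beta> ^ Suc j)"
proof (induction i)
  case 0
  then show ?case by simp
next
  case (Suc i)
  let ?r = "1 - (\<Sum>j<i. real (beta_expansion \<beta> j) / \<beta> ^ Suc j)"
  have pos: "\<beta> ^ Suc i > 0"
    using assms by simp
  with Suc have "0 \<le> \<beta> ^ Suc i * ?r"
    by (meson mult_nonneg_nonneg less_imp_le)
  then have "real (beta_expansion \<beta> i) \<le> \<beta> ^ Suc i * ?r"
    unfolding beta_expansion.simps [of \<beta> i] by (rule of_nat_floor)
  then have "real (beta_expansion \<beta> i) / \<beta> ^ Suc i \<le> ?r"
    using pos by (simp add: pos_divide_le_eq mult.commute)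
  then show ?case by simp
qed

lemma int_beta_expansion:
  assumes "\<beta> > 1"
  shows "int (beta_expansion \<beta> i) =
    \<lfloor>\<beta> ^ Suc i * (1 - (\<Sum>j<i. real (beta_expansion \<beta> j) / \<beta> ^ Suc j))\<rfloor>"
proof -
  have "0 \<le> \<beta> ^ Suc i * (1 - (\<Sum>j<i. real (beta_expansion \<beta> j) / \<beta> ^ Suc j))"
    using assms beta_expansion_remainder_nonneg [OF assms, of i]
    by (intro mult_nonneg_nonneg) simp_all
  then show ?thesis
    unfolding beta_expansion.simps [of \<beta> i] by simp
qed

definition lex_le :: "(nat \<Rightarrow> nat) \<Rightarrow> (nat \<Rightarrow> nat) \<Rightarrow> bool" where
  "lex_le x y \<longleftrightarrow> x = y \<or> less_fun x y"

definition beta_shift :: "real \<Rightarrow> (nat \<Rightarrow> nat) set" where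
  "beta_shift \<beta> =
     {x \<in> full_shift (nat \<lceil>\<beta>\<rceil>). \<forall>k. lex_le ((shift ^^ k) x) (beta_expansion \<beta>)}"

text \<open>
  In the following definitions \<open>n\<close> is the size of the alphabet, on which the metric depends.
  The frequencies lie in \<open>[0, 1]\<close>; they are taken in \<^typ>\<open>ereal\<close>, where \<^const>\<open>liminf\<close> and
  \<^const>\<open>limsup\<close> are available. The value at \<open>m = 0\<close> is irrelevant to both.
\<close>

definition close_freq :: "nat \<Rightarrow> (nat \<Rightarrow> nat) \<Rightarrow> (nat \<Rightarrow> nat) \<Rightarrow> real \<Rightarrow> nat \<Rightarrow> real" where
  "close_freq n x y t m =
     real (card {j. j < m \<and> seq_dist n ((shift ^^ j) x) ((shift ^^ j) y) < t}) / real m"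

definition lower_distr :: "nat \<Rightarrow> (nat \<Rightarrow> nat) \<Rightarrow> (nat \<Rightarrow> nat) \<Rightarrow> real \<Rightarrow> ereal" where
  "lower_distr n x y t = liminf (\<lambda>m. ereal (close_freq n x y t m))"

definition upper_distr :: "nat \<Rightarrow> (nat \<Rightarrow> nat) \<Rightarrow> (nat \<Rightarrow> nat) \<Rightarrow> real \<Rightarrow> ereal" where
  "upper_distr n x y t = limsup (\<lambda>m. ereal (close_freq n x y t m))"

definition DC1_scrambled :: "nat \<Rightarrow> (nat \<Rightarrow> nat) \<Rightarrow> (nat \<Rightarrow> nat) \<Rightarrow> bool" where
  "DC1_scrambled n x y \<longleftrightarrow>
     (\<forall>t>0. upper_distr n x y t = 1) \<and> (\<exists>s>0. lower_distr n x y s = 0)"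

definition DC1_chaotic :: "nat \<Rightarrow> (nat \<Rightarrow> nat) set \<Rightarrow> bool" where
  "DC1_chaotic n X \<longleftrightarrow> (\<exists>S\<subseteq>X. uncountable S \<and> pairwise (DC1_scrambled n) S)"

end

theory Submission
  imports Defs "HOL-Library.Nat_Bijection"
begin

text \<open>
  Since \<open>\<beta> > 1\<close>, the expansion of 1 exceeds \<open>1000\<dots>\<close>, so for a suitable \<open>M\<close> every 0-1 sequence
  whose 1s all sit at multiples of \<open>M\<close> lies in the beta shift. Cut the positions into the blocks
  \<open>[m!, (m + 1)!)\<close>, each of which makes up almost all of \<open>[0, (m + 1)!)\<close>, and fill each block with
  either zeros or the periodic pattern of 1s at the multiples of \<open>M\<close>. If two such sequences agree
  on infinitely many blocks and disagree on infinitely many blocks, they are DC1-scrambled: on a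
  block where they disagree, they differ within every window of length \<open>M\<close>. For each set \<open>a\<close> of
  naturals, fill the even blocks with zeros and let the odd ones encode membership in \<open>a\<close>,
  querying every natural infinitely often.
\<close>

section \<open>The expansion of 1 and sparse sequences in the beta shift\<close>

lemma shift_funpow: "(shift ^^ k) x = (\<lambda>i. x (k + i))"
  by (induction k arbitrary: x) (simp_all add: shift_def funpow_swap1)

lemma beta_expansion_0: "\<beta> > 1 \<Longrightarrow> beta_expansion \<beta> 0 \<ge> 1"
  using int_beta_expansion [of \<beta> 0] by simp linarith

text \<open>
  If all later digits vanished, the remainder \<open>1 - 1 / \<beta>\<close>, scaled by any power of \<open>\<beta>\<close>, would
  stay below 1.
\<close>

lemma beta_expansion_later_digit:
  assumes "\<beta> > 1" "beta_expansion \<beta> 0 = 1"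
  shows "\<exists>p>0. beta_expansion \<beta> p \<ge> 1"
proof (rule ccontr)
  assume "\<not> ?thesis"
  then have z: "beta_expansion \<beta> p = 0" if "p > 0" for p
    using that by (metis less_one not_le)
  obtain i where i: "1 / (\<beta> - 1) < \<beta> ^ i"
    using real_arch_pow [OF assms(1)] by blast
  let ?i = "Suc i"
  have "(\<Sum>j<?i. real (beta_expansion \<beta> j) / \<beta> ^ Suc j) = 1 / \<beta>"
    by (subst sum.lessThan_Suc_shift) (simp add: z assms(2))
  then have "int (beta_expansion \<beta> ?i) = \<lfloor>\<beta> ^ Suc ?i * (1 - 1 / \<beta>)\<rfloor>"
    using int_beta_expansion [OF assms(1), of ?i] by simp
  moreover have "1 \<le> \<beta> ^ Suc ?i * (1 - 1 / \<beta>)"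
  proof -
    have "1 < \<beta> ^ i * (\<beta> - 1)"
      using i assms(1) by (simp add: field_simps)
    with assms(1) have "1 < \<beta> * (\<beta> ^ i * (\<beta> - 1))"
      by (rule less_1_mult)
    also have "\<dots> = \<beta> ^ Suc ?i * (1 - 1 / \<beta>)"
      using assms(1) by (simp add: field_simps)
    finally show ?thesis
      by (rule less_imp_le)
  qed
  then have "1 \<le> \<lfloor>\<beta> ^ Suc ?i * (1 - 1 / \<beta>)\<rfloor>"
    by (simp only: le_floor_iff of_int_1)
  ultimately show False
    using z [of ?i] by linarith
qed

text \<open>If the expansion of 1 starts with at least 2, every 0-1 sequence is already smaller at
  its first entry. If it starts with 1, let p be the position of its next nonzero digit: a shift
  starting with 0 is smaller at once, and one starting with 1 continues with p zeros, so it agrees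
  with the expansion before p and is smaller at p.\<close>

lemma sparse_in_beta_shift:
  assumes "\<beta> > 1"
  obtains M where "M > 0"
    "\<And>x. \<lbrakk>\<And>i. x i \<le> 1; \<And>i. x i = 1 \<Longrightarrow> M dvd i\<rbrakk> \<Longrightarrow> x \<in> beta_shift \<beta>"
proof -
  let ?w = "beta_expansion \<beta>"
  have full: "x \<in> full_shift (nat \<lceil>\<beta>\<rceil>)" if "\<And>i. x i \<le> 1" for x
  proof -
    have "x i < nat \<lceil>\<beta>\<rceil>" for i
      using that [of i] assms by linarith
    then show ?thesis by (simp add: full_shift_def)
  qed
  show thesis
  proof (cases "?w 0 = 1")
    case True
    define p where "p = (LEAST p. p > 0 \<and> ?w p \<ge> 1)"
    have p: "p > 0 \<and> ?w p \<ge> 1"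
      unfolding p_def using beta_expansion_later_digit [OF assms True] by (rule LeastI_ex)
    have below: "?w i = 0" if "0 < i" "i < p" for i
      using not_less_Least [of i "\<lambda>p. p > 0 \<and> ?w p \<ge> 1"] that by (simp add: p_def)
    show thesis
    \<comment> \<open>Spacing \<open>p + 1\<close> keeps any second 1 out of the positions 1 to p
      after a 1, including p itself, where the comparison is decided.\<close>
    proof (rule that [of "Suc p"])
      fix x :: "nat \<Rightarrow> nat"
      assume le: "\<And>i. x i \<le> 1" and dvd: "\<And>i. x i = 1 \<Longrightarrow> Suc p dvd i"
      have "less_fun (\<lambda>i. x (k + i)) ?w" for k
      proof (cases "x k = 0")
        case True
        then show ?thesis
          using beta_expansion_0 [OF assms] by (intro less_funI exI [of _ 0]) simp
      next
        case False
        then have "x k = 1"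
          using le [of k] by linarith
        have zero: "x (k + i) = 0" if "0 < i" "i \<le> p" for i
        proof (rule ccontr)
          assume "x (k + i) \<noteq> 0"
          then have "Suc p dvd k + i"
            using le [of "k + i"] by (intro dvd) linarith
          then have "Suc p dvd i"
            using dvd [OF \<open>x k = 1\<close>] dvd_add_right_iff by blast
          then show False
            using that by (auto dest: dvd_imp_le)
        qed
        have "x (k + i) = ?w i" if "i < p" for i
          using zero [of i] below [of i] that \<open>x k = 1\<close> \<open>?w 0 = 1\<close> by (cases "i = 0") auto
        then show ?thesis
          using zero [of p] p by (intro less_funI exI [of _ p]) simp
      qed
      then show "x \<in> beta_shift \<beta>"
        using full le by (simp add: beta_shift_def lex_le_def shift_funpow)
    qed simp
  next
    case False
    then have "?w 0 \<ge> 2"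
      using beta_expansion_0 [OF assms] by linarith
    show thesis
    proof (rule that [of 1])
      fix x :: "nat \<Rightarrow> nat"
      assume le: "\<And>i. x i \<le> 1"
      have "less_fun (\<lambda>i. x (k + i)) ?w" for k
        using le [of k] \<open>?w 0 \<ge> 2\<close> by (intro less_funI exI [of _ 0]) simp
      then show "x \<in> beta_shift \<beta>"
        using full le by (simp add: beta_shift_def lex_le_def shift_funpow)
    qed simp
  qed
qed

section \<open>Distances and frequencies at the end of a block\<close>

lemma seq_dist_ge:
  assumes "n \<ge> 1" "i < M" "x i \<noteq> y i"
  shows "seq_dist n x y \<ge> inverse (real n ^ M)"
proof -
  have "(LEAST k. x k \<noteq> y k) \<le> i"
    using assms(3) by (rule Least_le)
  then have "real n ^ Suc (LEAST k. x k \<noteq> y k) \<le> real n ^ M"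
    using assms by (intro power_increasing) auto
  then have "inverse (real n ^ M) \<le> inverse (real n ^ Suc (LEAST k. x k \<noteq> y k))"
    using assms(1) by (intro le_imp_inverse_le) auto
  then show ?thesis
    using assms(3) by (auto simp: seq_dist_def simp del: power_Suc)
qed

lemma seq_dist_le:
  assumes "n \<ge> 1" "\<And>i. i < M \<Longrightarrow> x i = y i"
  shows "seq_dist n x y \<le> inverse (real n ^ M)"
proof (cases "x = y")
  case False
  then have "x (LEAST k. x k \<noteq> y k) \<noteq> y (LEAST k. x k \<noteq> y k)"
    by (intro LeastI_ex [of "\<lambda>k. x k \<noteq> y k"]) auto
  then have "M \<le> (LEAST k. x k \<noteq> y k)"
    using assms(2) not_le by blast
  then have "real n ^ M \<le> real n ^ Suc (LEAST k. x k \<noteq> y k)"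
    using assms by (intro power_increasing) auto
  then have "inverse (real n ^ Suc (LEAST k. x k \<noteq> y k)) \<le> inverse (real n ^ M)"
    using assms(1) by (intro le_imp_inverse_le) auto
  then show ?thesis
    using False by (simp add: seq_dist_def del: power_Suc)
qed (simp add: seq_dist_def)

lemma close_freq_le_1: "close_freq n x y t m \<le> 1"
proof -
  have "card {j. j < m \<and> seq_dist n ((shift ^^ j) x) ((shift ^^ j) y) < t} \<le> card {..<m}"
    by (intro card_mono) auto
  then show ?thesis
    by (auto simp: close_freq_def divide_le_eq_1)
qed

text \<open>A window of length L that starts at j with \<open>a \<le> j < b - L\<close> stays inside
  the region of agreement, so at most \<open>a + L\<close> of the b shifts can be far apart.\<close>

lemma close_freq_ge:
  assumes "n \<ge> 1" "inverse (real n ^ L) < t" "b > 0"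
    and agree: "\<And>i. \<lbrakk>a \<le> i; i < b\<rbrakk> \<Longrightarrow> x i = y i"
  shows "1 - real (a + L) / real b \<le> close_freq n x y t b"
proof -
  let ?C = "{j. j < b \<and> seq_dist n ((shift ^^ j) x) ((shift ^^ j) y) < t}"
  have "{a..<b - L} \<subseteq> ?C"
  proof
    fix j assume j: "j \<in> {a..<b - L}"
    have "seq_dist n ((shift ^^ j) x) ((shift ^^ j) y) \<le> inverse (real n ^ L)"
      using j assms(1) agree by (intro seq_dist_le) (auto simp: shift_funpow)
    with j assms(2) show "j \<in> ?C"
      by auto
  qed
  then have "card {a..<b - L} \<le> card ?C"
    by (intro card_mono) auto
  \<comment> \<open>This also holds when the interval is empty: truncated subtraction then gives
    \<open>b \<le> a + L\<close>.\<close>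
  then have "b \<le> card ?C + (a + L)"
    unfolding card_atLeastLessThan by linarith
  then have "real b - real (a + L) \<le> real (card ?C)"
    by linarith
  then have "(real b - real (a + L)) / real b \<le> real (card ?C) / real b"
    by (rule divide_right_mono) simp
  then show ?thesis
    using \<open>b > 0\<close> by (simp add: close_freq_def diff_divide_distrib)
qed

text \<open>Close pairs can occur only before a or among the last M positions, where the window
  sticks out of the block.\<close>

lemma close_freq_le:
  assumes "n \<ge> 1"
    and differ: "\<And>j. \<lbrakk>a \<le> j; j + M \<le> b\<rbrakk> \<Longrightarrow> \<exists>i<M. x (j + i) \<noteq> y (j + i)"
  shows "close_freq n x y (inverse (real n ^ M)) b \<le> real (a + M) / real b"
proof -
  let ?t = "inverse (real n ^ M)"
  let ?C = "{j. j < b \<and> seq_dist n ((shift ^^ j) x) ((shift ^^ j) y) < ?t}"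
  have "?C \<subseteq> {..<a} \<union> {b - M..<b}"
  proof
    fix j assume j: "j \<in> ?C"
    have "\<not> (a \<le> j \<and> j + M \<le> b)"
    proof
      assume "a \<le> j \<and> j + M \<le> b"
      then obtain i where "i < M" "(shift ^^ j) x i \<noteq> (shift ^^ j) y i"
        using differ by (auto simp: shift_funpow)
      with assms(1) have "?t \<le> seq_dist n ((shift ^^ j) x) ((shift ^^ j) y)"
        by (rule seq_dist_ge)
      with j show False
        by simp
    qed
    with j show "j \<in> {..<a} \<union> {b - M..<b}"
      by auto
  qed
  then have "card ?C \<le> card ({..<a} \<union> {b - M..<b})"
    by (intro card_mono) auto
  also have "\<dots> \<le> a + M"
    using card_Un_le [of "{..<a}" "{b - M..<b}"] by simp
  finally show ?thesis
    unfolding close_freq_def by (intro divide_right_mono) simp_all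
qed

section \<open>From factorial blocks to limits of frequencies\<close>

lemma tendsto_block_ratio: "(\<lambda>m. real (fact m + L) / real (fact (Suc m))) \<longlonglongrightarrow> 0"
proof (rule tendsto_sandwich [where f = "\<lambda>_. 0"])
  \<comment> \<open>From \<open>L \<le> L * m!\<close> the numerator is at most
    \<open>(1 + L) * m!\<close>, and \<open>m!\<close> cancels.\<close>
  have "real (fact m + L) / real (fact (Suc m)) \<le> (1 + real L) / real (Suc m)" for m
  proof -
    have "real L * 1 \<le> real L * fact m"
      using fact_ge_1 by (rule mult_left_mono) simp
    then have "real (fact m + L) \<le> (1 + real L) * fact m"
      by (simp add: algebra_simps)
    then have "real (fact m + L) / fact m / real (Suc m) \<le> (1 + real L) / real (Suc m)"
      by (intro divide_right_mono) (simp_all add: divide_le_eq)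
    then show ?thesis
      by (simp only: fact_Suc of_nat_mult of_nat_fact of_nat_id divide_divide_eq_left mult.commute)
  qed
  then show "\<forall>\<^sub>F m in sequentially.
      real (fact m + L) / real (fact (Suc m)) \<le> (1 + real L) / real (Suc m)"
    by (rule always_eventually [OF allI])
  show "(\<lambda>m. (1 + real L) / real (Suc m)) \<longlonglongrightarrow> 0"
    by (rule LIMSEQ_Suc [OF lim_const_over_n])
  show "\<forall>\<^sub>F m in sequentially. 0 \<le> real (fact m + L) / real (fact (Suc m))"
    by (intro always_eventually allI divide_nonneg_nonneg of_nat_0_le_iff)
qed (rule tendsto_const)

text \<open>Lets estimates at the block ends contradict a bound that holds for all large m; block
  ends are unbounded since \<open>Suc m \<le> fact (Suc m)\<close>.\<close>

lemma frequently_fact: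
  assumes "\<exists>\<^sub>F m in sequentially. P (fact (Suc m) :: nat)"
  shows "\<exists>\<^sub>F m in sequentially. P m"
  unfolding frequently_sequentially
proof
  fix N
  have "\<exists>m\<ge>N. P (fact (Suc m))"
    using assms unfolding frequently_sequentially by (rule spec)
  then obtain m where m: "m \<ge> N" "P (fact (Suc m))"
    by (elim exE conjE)
  have "N \<le> Suc m"
    using m(1) by simp
  also have "\<dots> \<le> fact (Suc m)"
    by (rule fact_ge_self)
  finally show "\<exists>n\<ge>N. P n"
    using m(2) by (intro exI conjI)
qed

text \<open>At the end of an agreeing block the frequency is at least \<open>1 - e m\<close> with
  \<open>e m\<close> tending to 0, so no \<open>d < 1\<close> bounds the frequencies
  eventually.\<close>

lemma upper_distr_eq_1:
  assumes "n \<ge> 2" "t > 0"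
    and agree: "\<exists>\<^sub>F m in sequentially. \<forall>i. fact m \<le> i \<and> i < fact (Suc m) \<longrightarrow> x i = y i"
  shows "upper_distr n x y t = 1"
proof (rule antisym)
  show "upper_distr n x y t \<le> 1"
    unfolding upper_distr_def by (intro Limsup_bounded always_eventually) (simp add: close_freq_le_1)
  \<comment> \<open>L is the number of agreeing entries that forces the distance below t.\<close>
  obtain L where "inverse t < real n ^ L"
    using real_arch_pow [of "real n"] assms(1) by auto
  then have L: "inverse (real n ^ L) < t"
    using assms by (metis inverse_inverse_eq inverse_less_iff_less inverse_positive_iff_positive less_trans)
  define e where "e m = real (fact m + L) / real (fact (Suc m))" for m
  have freq: "1 - e m \<le> close_freq n x y t (fact (Suc m))"
    if "\<forall>i. fact m \<le> i \<and> i < fact (Suc m) \<longrightarrow> x i = y i" for m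
    unfolding e_def using assms(1) L that by (intro close_freq_ge) (auto simp del: fact_Suc)
  show "1 \<le> upper_distr n x y t"
  proof (rule ccontr)
    assume "\<not> 1 \<le> upper_distr n x y t"
    then obtain d where d: "upper_distr n x y t < ereal d" "d < 1"
      using ereal_dense2 [of "upper_distr n x y t" 1] by (auto simp: one_ereal_def not_le)
    have "\<forall>\<^sub>F m in sequentially. e m < 1 - d"
      unfolding e_def using d(2) by (intro order_tendstoD(2) [OF tendsto_block_ratio]) simp
    from frequently_eventually_conj [OF agree this]
    have "\<exists>\<^sub>F m in sequentially. d < close_freq n x y t (fact (Suc m))"
    proof (rule frequently_elim1, elim conjE)
      fix m
      assume "\<forall>i. fact m \<le> i \<and> i < fact (Suc m) \<longrightarrow> x i = y i"
        and "e m < 1 - d"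
      from freq [OF this(1)] this(2) show "d < close_freq n x y t (fact (Suc m))"
        by linarith
    qed
    then have "\<exists>\<^sub>F m in sequentially. d < close_freq n x y t m"
      by (rule frequently_fact)
    moreover have "\<forall>\<^sub>F m in sequentially. ereal (close_freq n x y t m) < ereal d"
      using d(1) unfolding upper_distr_def by (rule Limsup_lessD)
    then have "\<forall>\<^sub>F m in sequentially. \<not> d < close_freq n x y t m"
      by (rule eventually_mono) simp
    ultimately show False
      by (simp add: frequently_def)
  qed
qed

text \<open>Dually, at the end of a differing block the frequency is at most \<open>e m\<close>. The
  threshold is the least distance possible for points that differ in their first M entries.\<close>

lemma lower_distr_eq_0:
  assumes "n \<ge> 1"
    and differ: "\<exists>\<^sub>F m in sequentially. \<forall>j. fact m \<le> j \<and> j + M \<le> fact (Suc m) \<longrightarrow>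
      (\<exists>i<M. x (j + i) \<noteq> y (j + i))"
  shows "lower_distr n x y (inverse (real n ^ M)) = 0"
proof (rule antisym)
  let ?t = "inverse (real n ^ M)"
  show "0 \<le> lower_distr n x y ?t"
    unfolding lower_distr_def
    by (intro Liminf_bounded always_eventually) (simp add: close_freq_def)
  define e where "e m = real (fact m + M) / real (fact (Suc m))" for m
  have freq: "close_freq n x y ?t (fact (Suc m)) \<le> e m"
    if "\<forall>j. fact m \<le> j \<and> j + M \<le> fact (Suc m) \<longrightarrow> (\<exists>i<M. x (j + i) \<noteq> y (j + i))" for m
    unfolding e_def using assms(1) that by (intro close_freq_le) (auto simp del: fact_Suc)
  show "lower_distr n x y ?t \<le> 0"
  proof (rule ccontr)
    assume "\<not> lower_distr n x y ?t \<le> 0"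
    then obtain d where d: "ereal d < lower_distr n x y ?t" "d > 0"
      using ereal_dense2 [of 0 "lower_distr n x y ?t"] by (auto simp: zero_ereal_def not_le)
    have "\<forall>\<^sub>F m in sequentially. e m < d"
      unfolding e_def using d(2) by (intro order_tendstoD(2) [OF tendsto_block_ratio]) simp
    from frequently_eventually_conj [OF differ this]
    have "\<exists>\<^sub>F m in sequentially. close_freq n x y ?t (fact (Suc m)) < d"
    proof (rule frequently_elim1, elim conjE)
      fix m
      assume "\<forall>j. fact m \<le> j \<and> j + M \<le> fact (Suc m) \<longrightarrow> (\<exists>i<M. x (j + i) \<noteq> y (j + i))"
        and "e m < d"
      from freq [OF this(1)] this(2) show "close_freq n x y ?t (fact (Suc m)) < d"
        by linarith
    qed
    then have "\<exists>\<^sub>F m in sequentially. close_freq n x y ?t m < d"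
      by (rule frequently_fact)
    moreover have "\<forall>\<^sub>F m in sequentially. ereal d < ereal (close_freq n x y ?t m)"
      using d(1) unfolding lower_distr_def by (rule less_LiminfD)
    then have "\<forall>\<^sub>F m in sequentially. \<not> close_freq n x y ?t m < d"
      by (rule eventually_mono) simp
    ultimately show False
      by (simp add: frequently_def)
  qed
qed

section \<open>The scrambled family indexed by sets of naturals\<close>

lemma not_DC1_scrambled_refl:
  assumes "n \<ge> 2"
  shows "\<not> DC1_scrambled n x x"
proof
  assume "DC1_scrambled n x x"
  then obtain s where s: "s > 0" "lower_distr n x x s = 0"
    by (auto simp: DC1_scrambled_def)
  \<comment> \<open>The index 0 is excluded because the frequency there is
    \<open>0 / 0 = 0\<close>.\<close>
  have "\<forall>\<^sub>F m in sequentially. ereal (close_freq n x x s m) \<ge> 1"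
    using eventually_gt_at_top [of "0 :: nat"]
    by eventually_elim (use s in \<open>simp add: close_freq_def seq_dist_def\<close>)
  then have "1 \<le> lower_distr n x x s"
    unfolding lower_distr_def by (rule Liminf_bounded)
  with s show False by simp
qed

lemma uncountable_UNIV_set_nat: "uncountable (UNIV :: nat set set)"
  using Cantors_theorem [of "UNIV :: nat set"] by (auto simp: uncountable_def)

text \<open>The first component of the decoded pair is the number queried; the second is a free
  counter that repeats each query infinitely often.\<close>

definition active_block :: "nat set \<Rightarrow> nat \<Rightarrow> bool" where
  "active_block a m \<longleftrightarrow> odd m \<and> fst (prod_decode (m div 2)) \<in> a"

text \<open>Position 0 lies in no block, as \<open>fact m \<ge> 1\<close>, so its entry is
  0.\<close>

definition block_seq :: "nat \<Rightarrow> nat set \<Rightarrow> nat \<Rightarrow> nat" where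
  "block_seq M a i =
     of_bool (M dvd i \<and> (\<exists>m. fact m \<le> i \<and> i < fact (Suc m) \<and> active_block a m))"

text \<open>Factorials are monotone, so the blocks are disjoint and the block containing i is
  unique.\<close>

lemma block_seq_eq:
  assumes "fact m \<le> i" "i < fact (Suc m)"
  shows "block_seq M a i = of_bool (M dvd i \<and> active_block a m)"
proof -
  have "m' = m" if "fact m' \<le> i" "i < fact (Suc m')" for m'
  proof (rule antisym; rule ccontr)
    assume "\<not> m' \<le> m"
    then have "fact (Suc m) \<le> (fact m' :: nat)"
      by (intro fact_mono) simp
    with that assms show False by linarith
  next
    assume "\<not> m \<le> m'"
    then have "fact (Suc m') \<le> (fact m :: nat)"
      by (intro fact_mono) simp
    with that assms show False by linarith
  qed
  with assms have "(\<exists>m. fact m \<le> i \<and> i < fact (Suc m) \<and> active_block a m) \<longleftrightarrow> active_block a m"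
    by blast
  then show ?thesis
    by (simp only: block_seq_def)
qed

lemma frequently_active_block_differ:
  assumes "a \<noteq> b"
  shows "\<exists>\<^sub>F m in sequentially. active_block a m \<noteq> active_block b m"
  unfolding frequently_sequentially
proof
  fix N
  obtain k where k: "(k \<in> a) \<noteq> (k \<in> b)"
    using assms by blast
  \<comment> \<open>An odd block that queries k; the counter N pushes its index past N.\<close>
  let ?m = "Suc (2 * prod_encode (k, N))"
  have "N \<le> ?m"
    using le_prod_encode_2 [of N k] by linarith
  moreover have "active_block a ?m \<noteq> active_block b ?m"
    using k by (simp add: active_block_def)
  ultimately show "\<exists>m\<ge>N. active_block a m \<noteq> active_block b m"
    by blast
qed

lemma DC1_scrambled_block_seq:
  assumes "n \<ge> 2" "M > 0" "a \<noteq> b"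
  shows "DC1_scrambled n (block_seq M a) (block_seq M b)"
  unfolding DC1_scrambled_def
proof (intro conjI allI impI)
  \<comment> \<open>Even blocks are inactive for every set, so both sequences vanish there.\<close>
  have "\<exists>\<^sub>F m in sequentially. even m"
    unfolding frequently_sequentially by (metis dvd_triv_left le_add2 mult_2)
  then have agree: "\<exists>\<^sub>F m in sequentially. \<forall>i. fact m \<le> i \<and> i < fact (Suc m) \<longrightarrow>
      block_seq M a i = block_seq M b i"
    by (rule frequently_elim1) (auto simp: block_seq_eq active_block_def simp del: fact_Suc)
  show "upper_distr n (block_seq M a) (block_seq M b) t = 1" if "t > 0" for t
    using assms(1) that agree by (rule upper_distr_eq_1)
  have "\<exists>\<^sub>F m in sequentially. \<forall>j. fact m \<le> j \<and> j + M \<le> fact (Suc m) \<longrightarrow>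
      (\<exists>i<M. block_seq M a (j + i) \<noteq> block_seq M b (j + i))"
    using frequently_active_block_differ [OF assms(3)]
  proof (rule frequently_elim1, intro allI impI, elim conjE)
    fix m j
    assume m: "active_block a m \<noteq> active_block b m"
      and j: "fact m \<le> j" "j + M \<le> fact (Suc m)"
    \<comment> \<open>The distance from j to the next multiple of M; the outer \<open>mod\<close>
      makes it 0 when M divides j. At \<open>j + i\<close> exactly one of the two sequences has a
      1.\<close>
    define i where "i = (M - j mod M) mod M"
    have "i < M"
      using assms(2) by (simp add: i_def)
    moreover have "M dvd j + i"
      unfolding i_def dvd_eq_mod_eq_0 mod_add_right_eq
      by (metis assms(2) le_add_diff_inverse mod_add_left_eq mod_le_divisor mod_self)
    moreover have "fact m \<le> j + i" "j + i < fact (Suc m)"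
      using j \<open>i < M\<close> by linarith+
    ultimately show "\<exists>i<M. block_seq M a (j + i) \<noteq> block_seq M b (j + i)"
      using m by (intro exI [of _ i]) (simp add: block_seq_eq [of m] del: fact_Suc)
  qed
  then have "lower_distr n (block_seq M a) (block_seq M b) (inverse (real n ^ M)) = 0"
    using assms(1) by (intro lower_distr_eq_0) auto
  moreover have "inverse (real n ^ M) > 0"
    using assms(1) by simp
  ultimately show "\<exists>s>0. lower_distr n (block_seq M a) (block_seq M b) s = 0"
    by blast
qed

theorem theorem28:
  fixes \<beta> :: real
  assumes "\<beta> > 1"
  shows "DC1_chaotic (nat \<lceil>\<beta>\<rceil>) (beta_shift \<beta>)"
proof -
  have n: "nat \<lceil>\<beta>\<rceil> \<ge> 2"
    using assms by linarith
  obtain M where M: "M > 0"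
    "\<And>x. \<lbrakk>\<And>i. x i \<le> 1; \<And>i. x i = 1 \<Longrightarrow> M dvd i\<rbrakk> \<Longrightarrow> x \<in> beta_shift \<beta>"
    using sparse_in_beta_shift [OF assms] by blast
  have scr: "DC1_scrambled (nat \<lceil>\<beta>\<rceil>) (block_seq M a) (block_seq M b)" if "a \<noteq> b" for a b
    using n M(1) that by (rule DC1_scrambled_block_seq)
  \<comment> \<open>If distinct sets gave the same sequence, it would be scrambled with
    itself.\<close>
  have "inj (block_seq M)"
    using scr not_DC1_scrambled_refl [OF n] by (metis injI)
  then have "uncountable (range (block_seq M))"
    using uncountable_UNIV_set_nat countable_image_inj_eq by blast
  moreover have "range (block_seq M) \<subseteq> beta_shift \<beta>"
    by (auto intro!: M(2) simp: block_seq_def of_bool_def simp del: fact_Suc split: if_splits)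
  moreover have "pairwise (DC1_scrambled (nat \<lceil>\<beta>\<rceil>)) (range (block_seq M))"
    by (auto simp: pairwise_def intro!: scr)
  ultimately show ?thesis
    unfolding DC1_chaotic_def by blast
qed

end
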